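(* $\mathrm{rDiv} \nleq_2 \mathrm{Pure}$; that is, robust division is not reducible to the problem of finding a pure equilibrium in a bi-matrix game (of arbitrary size) possessing one.
   Context: Representation of reals. Fix a bijection $\nu:\mathbb{N}\to\mathbb{Q}$ with $\nu(0)=0$ such that the usual operations on $\mathbb{Q}$ are computable with respect to $\nu$. A sequence $w\in\mathbb{N}^{\mathbb{N}}$ is a $\rho$-name of $x\in\mathbb{R}$, written $\rho(w)=x$, if $|\nu(w(i))-x|\le 2^{-i}$ for all $i\in\mathbb{N}$. Problems and reducibility. $\mathbb{N}^{\mathbb{N}}$ carries its usual (Baire) topology, countable sets such as $\mathbb{N}$ or finite sets are discrete, products carry the product topology. A problem (multi-valued function) $P$ has a domain $\mathrm{dom}(P)$ of inputs (names) and assigns to each input a nonempty set of admissible outputs (names); $P$ is identified with the set of its choice functions, i.e. all functions $f$ on $\mathrm{dom}(P)$ with $f(w)$ admissible for every $w$. $P\le_2 Q$ holds iff there are continuous partial functions $F,G$ such that for each $g\in Q$ the function $w\mapsto F(w,g(G(w)))$ belongs to $P$ (in particular is defined on $\mathrm{dom}(P)$). Robust division. $\mathrm{rDiv}$ is the set of functions $d$ defined on $\{(u,v)\mid 0\le\rho(u)\le\rho(v)\}$ (pairs of $\rho$-names), whose values are $\rho$-names of real numbers, satisfying $\rho(d(u,v))=\rho(u)/\rho(v)$ whenever $\rho(v)>0$ (the value is an arbitrary real if $\rho(v)=0$). Games. An $n\times m$ bi-matrix game is a pair $(A,B)$ of real $n\times m$ matrices. A pure equilibrium is a pair $(i,j)\in\{1,\dots,n\}\times\{1,\dots,m\}$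 with $A_{ij}\ge A_{kj}$ for all $k\le n$ and $B_{ij}\ge B_{il}$ for all $l\le m$. A name of a game consists of the size $(n,m)$ (readable from a finite prefix of the name) followed by $\rho$-names of all entries of $A$ and $B$ (combined by standard tupling of sequences). $\mathrm{Pure}$ is the problem: given a name of a bi-matrix game (of any size $n\times m$, $n,m\ge1$) that has a pure equilibrium, output some pure equilibrium $(i,j)$ (a discrete value). *)

theory Defs
  imports "HOL-Analysis.Function_Topology" "Jordan_Normal_Form.Matrix"
begin

text \<open>Total recursive functions of a given arity. The argument lists are only meaningful
  when their length is the arity. The minimisation rule is restricted to regular functions,
  so that exactly the total computable functions arise.\<close>

inductive recursive_fun :: "nat \<Rightarrow> (nat list \<Rightarrow> nat) \<Rightarrow> bool" where
  zero: "recursive_fun k (\<lambda>xs. 0)"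
| succ: "recursive_fun 1 (\<lambda>xs. Suc (hd xs))"
| proj: "i < k \<Longrightarrow> recursive_fun k (\<lambda>xs. xs ! i)"
| comp: "\<lbrakk>recursive_fun (length hs) g; \<forall>h\<in>set hs. recursive_fun k h\<rbrakk>
    \<Longrightarrow> recursive_fun k (\<lambda>xs. g (map (\<lambda>h. h xs) hs))"
| prim_rec: "\<lbrakk>recursive_fun k g; recursive_fun (k + 2) h\<rbrakk>
    \<Longrightarrow> recursive_fun (Suc k)
          (\<lambda>xs. rec_nat (g (tl xs)) (\<lambda>n r. h (n # r # tl xs)) (hd xs))"
| minimize: "\<lbrakk>recursive_fun (Suc k) g; \<forall>xs. length xs = k \<longrightarrow> (\<exists>n. g (n # xs) = 0)\<rbrakk>
    \<Longrightarrow> recursive_fun k (\<lambda>xs. LEAST n. g (n # xs) = 0)"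

definition computable_op :: "(nat \<Rightarrow> rat) \<Rightarrow> (rat \<Rightarrow> rat \<Rightarrow> rat) \<Rightarrow> bool" where
  "computable_op \<nu> f \<longleftrightarrow>
     (\<exists>h. recursive_fun 2 h \<and> (\<forall>a b. \<nu> (h [a, b]) = f (\<nu> a) (\<nu> b)))"

text \<open>The convention \<open>x / 0 = 0\<close> does not affect computability of division, because
  \<open>0\<close> is the only index of the rational number zero.\<close>

definition rat_numbering :: "(nat \<Rightarrow> rat) \<Rightarrow> bool" where
  "rat_numbering \<nu> \<longleftrightarrow> bij \<nu> \<and> \<nu> 0 = 0 \<and>
     computable_op \<nu> (+) \<and> computable_op \<nu> (-) \<and> computable_op \<nu> (*) \<and> computable_op \<nu> (/)"

type_synonym baire = "nat \<Rightarrow> nat"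

text \<open>\<open>rho_name \<nu> w x\<close> stands for \<open>\<rho>(w) = x\<close>.\<close>

definition rho_name :: "(nat \<Rightarrow> rat) \<Rightarrow> baire \<Rightarrow> real \<Rightarrow> bool" where
  "rho_name \<nu> w x \<longleftrightarrow> (\<forall>i. \<bar>of_rat (\<nu> (w i)) - x\<bar> \<le> 1 / 2 ^ i)"

lemma rho_name_unique:
  assumes "rho_name \<nu> w x" "rho_name \<nu> w y"
  shows "x = y"
proof (rule ccontr)
  assume "x \<noteq> y"
  then obtain i where i: "(1 / 2) ^ i < \<bar>x - y\<bar> / 2"
    using real_arch_pow_inv[of "\<bar>x - y\<bar> / 2" "1 / 2"] by auto
  define e q where "e = (1 / 2 :: real) ^ i" and "q = (of_rat (\<nu> (w i)) :: real)"
  have "\<bar>q - x\<bar> \<le> e" "\<bar>q - y\<bar> \<le> e"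
    using assms by (auto simp: rho_name_def power_one_over e_def q_def)
  moreover have "2 * e < \<bar>x - y\<bar>"
    using i by (simp add: e_def)
  ultimately show False by linarith
qed

text \<open>A problem is the set of its choice functions, which are partial functions whose domain
  is the domain of the problem.\<close>

type_synonym ('a, 'b) problem = "('a \<rightharpoonup> 'b) set"

definition choice_functions :: "'a set \<Rightarrow> ('a \<Rightarrow> 'b set) \<Rightarrow> ('a, 'b) problem" where
  "choice_functions D R = {f. dom f = D \<and> (\<forall>w\<in>D. the (f w) \<in> R w)}"

definition continuous_partial ::
    "('a::topological_space \<rightharpoonup> 'b::topological_space) \<Rightarrow> bool" where
  "continuous_partial F \<longleftrightarrow> continuous_on (dom F) (\<lambda>w. the (F w))"

text \<open>Membership in \<open>P\<close> forces the composite to have exactly the domain of \<open>P\<close>. This is no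
  restriction: \<open>G\<close> may always be restricted to that domain.\<close>

definition reducible2 ::
    "('a::topological_space, 'b::topological_space) problem \<Rightarrow>
     ('c::topological_space, 'd::topological_space) problem \<Rightarrow> bool"
    (infix "\<le>\<^sub>2" 50) where
  "P \<le>\<^sub>2 Q \<longleftrightarrow>
     (\<exists>(F :: 'a \<times> 'd \<rightharpoonup> 'b) (G :: 'a \<rightharpoonup> 'c).
        continuous_partial F \<and> continuous_partial G \<and>
        (\<forall>g\<in>Q. (\<lambda>w. Option.bind (G w) (\<lambda>v. Option.bind (g v) (\<lambda>y. F (w, y)))) \<in> P))"

definition rDiv :: "(nat \<Rightarrow> rat) \<Rightarrow> (baire \<times> baire, baire) problem" where
  "rDiv \<nu> = choice_functions
     {(u, v). \<exists>x y. rho_name \<nu> u x \<and> rho_name \<nu> v y \<and> 0 \<le> x \<and> x \<le> y}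
     (\<lambda>(u, v). {d. (\<exists>z. rho_name \<nu> d z) \<and>
        (\<forall>x y. rho_name \<nu> u x \<and> rho_name \<nu> v y \<and> y > 0 \<longrightarrow> rho_name \<nu> d (x / y))})"

text \<open>Matrix indices start at \<open>0\<close>, so the strategies are \<open>{0..<n}\<close> and \<open>{0..<m}\<close>.\<close>

definition bimatrix_game :: "nat \<Rightarrow> nat \<Rightarrow> real mat \<times> real mat \<Rightarrow> bool" where
  "bimatrix_game n m = (\<lambda>(A, B).
     1 \<le> n \<and> 1 \<le> m \<and> A \<in> carrier_mat n m \<and> B \<in> carrier_mat n m)"

definition pure_equilibria :: "real mat \<times> real mat \<Rightarrow> (nat \<times> nat) set" where
  "pure_equilibria = (\<lambda>(A, B). {(i, j). i < dim_row A \<and> j < dim_col A \<and>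
     (\<forall>k<dim_row A. A $$ (i, j) \<ge> A $$ (k, j)) \<and>
     (\<forall>l<dim_col A. B $$ (i, j) \<ge> B $$ (i, l))})"

text \<open>The \<open>r\<close>-th component of a sequence that interleaves \<open>N\<close> sequences.\<close>

definition component :: "nat \<Rightarrow> nat \<Rightarrow> baire \<Rightarrow> baire" where
  "component N r p = (\<lambda>k. p (N * k + r))"

text \<open>A name starts with \<open>n\<close> and \<open>m\<close>. The remaining sequence interleaves names of the
  \<open>2 * n * m\<close> entries, those of \<open>A\<close> row by row followed by those of \<open>B\<close> row by row.\<close>

definition game_name :: "(nat \<Rightarrow> rat) \<Rightarrow> baire \<Rightarrow> real mat \<times> real mat \<Rightarrow> bool" where
  "game_name \<nu> w = (\<lambda>(A, B). \<exists>n m. w 0 = n \<and> w 1 = m \<and> bimatrix_game n m (A, B) \<and>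
     (\<forall>i<n. \<forall>j<m.
        rho_name \<nu> (component (2 * n * m) (i * m + j) (\<lambda>k. w (k + 2))) (A $$ (i, j)) \<and>
        rho_name \<nu> (component (2 * n * m) (n * m + i * m + j) (\<lambda>k. w (k + 2))) (B $$ (i, j))))"

lemma game_name_unique:
  assumes "game_name \<nu> w (A, B)" "game_name \<nu> w (A', B')"
  shows "(A, B) = (A', B')"
proof -
  have "A = A'"
    using assms by (intro eq_matI)
      (auto simp: game_name_def bimatrix_game_def, blast intro: rho_name_unique)
  moreover have "B = B'"
    using assms by (intro eq_matI)
      (auto simp: game_name_def bimatrix_game_def, blast intro: rho_name_unique)
  ultimately show ?thesis by simp
qed

definition Pure :: "(nat \<Rightarrow> rat) \<Rightarrow> (baire, nat \<times> nat) problem" where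
  "Pure \<nu> = choice_functions
     {w. \<exists>\<G>. game_name \<nu> w \<G> \<and> pure_equilibria \<G> \<noteq> {}}
     (\<lambda>w. {e. \<exists>\<G>. game_name \<nu> w \<G> \<and> e \<in> pure_equilibria \<G>})"

end

theory Submission imports Defs begin

text \<open>Near the input \<open>(0, 0)\<close> every ratio in \<open>[0, 1]\<close> occurs as a quotient. A pure equilibrium
  that occurs for games converging to the game \<open>\<G>\<close> assigned to \<open>(0, 0)\<close> is also an equilibrium
  of \<open>\<G>\<close>, and there are only finitely many of those. Hence, by continuity, the reduction can only
  produce finitely many ratios near \<open>(0, 0)\<close>.\<close>

lemma tendsto_coordinatewise_iff:
  fixes X :: "'a \<Rightarrow> 'i \<Rightarrow> 'b::topological_space"
  shows "(X \<longlongrightarrow> w) A \<longleftrightarrow> (\<forall>i. ((\<lambda>k. X k i) \<longlongrightarrow> w i) A)"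
  by (simp add: limitin_componentwise flip: limitin_canonical_iff euclidean_product_topology)

text \<open>Convergence is coordinatewise, and in the discrete space of natural numbers a convergent
  sequence is eventually constant.\<close>

lemma baire_tendsto_iff:
  "X \<longlonglongrightarrow> w \<longleftrightarrow> (\<forall>i. \<forall>\<^sub>F k in sequentially. X k i = w i)" for w :: baire
  by (subst tendsto_coordinatewise_iff) (simp add: tendsto_discrete)

text \<open>As soon as \<open>X k\<close> and \<open>w\<close> agree at position \<open>i\<close>,
  both reals lie within \<open>(1/2)^i\<close> of the same rational, hence within
  \<open>2 * (1/2)^i\<close> of each other.\<close>

lemma rho_name_tendsto:
  assumes "X \<longlonglongrightarrow> w" "\<And>k. rho_name \<nu> (X k) (x k)" "rho_name \<nu> w y"
  shows "x \<longlonglongrightarrow> y"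
proof (rule metric_LIMSEQ_I)
  fix r :: real
  assume "0 < r"
  then obtain i where i: "(1 / 2) ^ i < r / 2"
    using real_arch_pow_inv[of "r / 2" "1 / 2"] by auto
  have "\<forall>\<^sub>F k in sequentially. X k i = w i"
    using assms(1) by (simp add: baire_tendsto_iff)
  then obtain N where N: "\<And>k. k \<ge> N \<Longrightarrow> X k i = w i"
    by (auto simp: eventually_sequentially)
  have "dist (x k) y < r" if "k \<ge> N" for k
  proof -
    define q where "q = (of_rat (\<nu> (w i)) :: real)"
    have "\<bar>q - x k\<bar> \<le> (1 / 2) ^ i" "\<bar>q - y\<bar> \<le> (1 / 2) ^ i"
      using assms(2)[of k] assms(3) N[OF that]
      by (auto simp: rho_name_def power_one_over q_def dest: spec[of _ i])
    then show ?thesis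
      using i by (simp add: dist_real_def)
  qed
  then show "\<exists>N. \<forall>k\<ge>N. dist (x k) y < r" by blast
qed

lemma component_tendsto:
  assumes "W \<longlonglongrightarrow> w"
  shows "(\<lambda>k. component N r (\<lambda>l. W k (l + 2))) \<longlonglongrightarrow> component N r (\<lambda>l. w (l + 2))"
  using assms by (simp add: component_def baire_tendsto_iff)

text \<open>The entries of the games converge to those of the limit game, and the weak inequalities
  that define an equilibrium survive limits.\<close>

lemma pure_equilibrium_limit:
  assumes W: "W \<longlonglongrightarrow> w"
    and names: "\<And>k. game_name \<nu> (W k) (\<G> k)" "game_name \<nu> w \<H>"
    and eq: "\<And>k. e \<in> pure_equilibria (\<G> k)"
  shows "e \<in> pure_equilibria \<H>"
proof -
  obtain A B where H: "\<H> = (A, B)" by fastforce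
  obtain i j where e: "e = (i, j)" by fastforce
  define n m where "n = w 0" and "m = w 1"
  have "\<forall>\<^sub>F k in sequentially. W k 0 = n \<and> W k 1 = m"
    using W by (simp add: baire_tendsto_iff n_def m_def eventually_conj_iff)
  then obtain N where "\<And>k. k \<ge> N \<Longrightarrow> W k 0 = n \<and> W k 1 = m"
    by (auto simp: eventually_sequentially)
  \<comment> \<open>After a shift by \<open>N\<close> all games have the size of the limit game, so
    each entry is read from the same positions in all names and can be compared termwise.\<close>
  then have N: "W (k + N) 0 = n \<and> W (k + N) 1 = m" for k
    by simp
  define C D where "C k = fst (\<G> (k + N))" and "D k = snd (\<G> (k + N))" for k
  have G: "\<G> (k + N) = (C k, D k)" for k by (simp add: C_def D_def)
  have W': "(\<lambda>k. W (k + N)) \<longlonglongrightarrow> w"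
    using W by (rule LIMSEQ_ignore_initial_segment)
  have nameG: "game_name \<nu> (W (k + N)) (C k, D k)" for k
    using names(1)[of "k + N"] by (simp add: G)
  have dims: "dim_row A = n" "dim_col A = m" "dim_row (C k) = n" "dim_col (C k) = m" for k
    using names(2) nameG[of k] N[of k]
    by (auto simp: H game_name_def bimatrix_game_def n_def m_def)
  have eqG: "i < n" "j < m" "\<And>i'. i' < n \<Longrightarrow> C k $$ (i', j) \<le> C k $$ (i, j)"
      "\<And>j'. j' < m \<Longrightarrow> D k $$ (i, j') \<le> D k $$ (i, j)" for k
    using eq[of "k + N"] by (auto simp: G e pure_equilibria_def dims)
  have lim: "(\<lambda>k. C k $$ (i', j')) \<longlonglongrightarrow> A $$ (i', j')" "(\<lambda>k. D k $$ (i', j')) \<longlonglongrightarrow> B $$ (i', j')"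
    if "i' < n" "j' < m" for i' j'
  proof -
    show "(\<lambda>k. C k $$ (i', j')) \<longlonglongrightarrow> A $$ (i', j')"
      using names(2) nameG N that
      by (intro rho_name_tendsto[OF component_tendsto[OF W', of "2 * n * m" "i' * m + j'"], of \<nu>])
        (auto simp: H game_name_def n_def m_def)
    show "(\<lambda>k. D k $$ (i', j')) \<longlonglongrightarrow> B $$ (i', j')"
      using names(2) nameG N that
      by (intro rho_name_tendsto[OF component_tendsto[OF W', of "2 * n * m" "n * m + i' * m + j'"], of \<nu>])
        (auto simp: H game_name_def n_def m_def)
  qed
  have "A $$ (i', j) \<le> A $$ (i, j)" if "i' < n" for i'
    using LIMSEQ_le[OF lim(1)[OF that eqG(2)] lim(1)[OF eqG(1,2)]] eqG(3)[OF that] by blast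
  moreover have "B $$ (i, j') \<le> B $$ (i, j)" if "j' < m" for j'
    using LIMSEQ_le[OF lim(2)[OF eqG(1) that] lim(2)[OF eqG(1,2)]] eqG(4)[OF that] by blast
  ultimately show ?thesis
    using eqG(1,2) by (simp add: H e pure_equilibria_def dims)
qed

lemma finite_pure_equilibria: "finite (pure_equilibria \<G>)"
proof -
  have "pure_equilibria \<G> \<subseteq> {..<dim_row (fst \<G>)} \<times> {..<dim_col (fst \<G>)}"
    by (auto simp: pure_equilibria_def split: prod.splits)
  then show ?thesis by (rule finite_subset) simp
qed

text \<open>Replaces the quantifier over choice functions by one over admissible outputs at a single
  input: a choice function may be changed at one point to take any admissible value there.
  Nonemptiness guarantees that there is a choice function to start from.\<close>

lemma reducible2_choice_functionsE:
  assumes "choice_functions D R \<le>\<^sub>2 choice_functions D' R'"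
    and nonempty: "\<And>v. v \<in> D' \<Longrightarrow> R' v \<noteq> {}"
  obtains F G where "continuous_partial F" "continuous_partial G"
    "\<And>w. w \<in> D \<Longrightarrow> \<exists>v\<in>D'. G w = Some v \<and> (\<forall>y\<in>R' v. \<exists>z\<in>R w. F (w, y) = Some z)"
proof -
  obtain F G where cont: "continuous_partial F" "continuous_partial G"
    and red: "\<And>g. g \<in> choice_functions D' R' \<Longrightarrow>
      (\<lambda>w. Option.bind (G w) (\<lambda>v. Option.bind (g v) (\<lambda>y. F (w, y)))) \<in> choice_functions D R"
    using assms(1) by (auto simp: reducible2_def)
  define g where "g = (\<lambda>v. if v \<in> D' then Some (SOME y. y \<in> R' v) else None)"
  have g: "g \<in> choice_functions D' R'"
    using nonempty by (auto simp: choice_functions_def g_def some_in_eq split: if_splits)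
  have "\<exists>v\<in>D'. G w = Some v \<and> (\<forall>y\<in>R' v. \<exists>z\<in>R w. F (w, y) = Some z)" if w: "w \<in> D" for w
  proof -
    \<comment> \<open>Since \<open>g\<close> is defined only on \<open>D'\<close>, definedness of
      the composite at \<open>w\<close> forces \<open>G w\<close> to be a point of
      \<open>D'\<close>.\<close>
    have "w \<in> dom (\<lambda>w. Option.bind (G w) (\<lambda>v. Option.bind (g v) (\<lambda>y. F (w, y))))"
      using red[OF g] w by (simp add: choice_functions_def)
    then obtain v where v: "G w = Some v" "v \<in> D'"
      by (auto simp: g_def bind_eq_Some_conv split: if_splits)
    have "\<exists>z\<in>R w. F (w, y) = Some z" if "y \<in> R' v" for y
    proof -
      \<comment> \<open>Redirecting \<open>g\<close> at \<open>v\<close> feeds the arbitrary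
        admissible \<open>y\<close> to \<open>F\<close>.\<close>
      have "g(v \<mapsto> y) \<in> choice_functions D' R'"
        using g v(2) that by (auto simp: choice_functions_def)
      from red[OF this] w have
        "w \<in> dom (\<lambda>w. Option.bind (G w) (\<lambda>v'. Option.bind ((g(v \<mapsto> y)) v') (\<lambda>y. F (w, y))))"
        "the (Option.bind (G w) (\<lambda>v'. Option.bind ((g(v \<mapsto> y)) v') (\<lambda>y. F (w, y)))) \<in> R w"
        unfolding choice_functions_def by blast+
      then show ?thesis using v(1) by auto
    qed
    with v show ?thesis by blast
  qed
  with cont that show thesis by blast
qed

lemma continuous_partial_tendsto:
  assumes "continuous_partial F" "X \<longlonglongrightarrow> x" "\<And>k. F (X k) = Some (Y k)" "F x = Some y"
  shows "Y \<longlonglongrightarrow> y"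
proof -
  have "(\<lambda>k. the (F (X k))) \<longlonglongrightarrow> the (F x)"
    using assms by (intro continuous_on_tendsto_compose[of "dom F" "\<lambda>w. the (F w)"])
      (auto simp: continuous_partial_def dom_def)
  then show ?thesis by (simp add: assms)
qed

text \<open>Used for numerator and denominator: names of \<open>c / 2^k\<close> and
  \<open>1 / 2^k\<close> approach the zero name while their quotient stays \<open>c\<close>.\<close>

lemma rho_name_null_sequence:
  assumes "bij \<nu>" "\<nu> 0 = 0" "0 \<le> c" "c \<le> (1 :: rat)"
  obtains X where "X \<longlonglongrightarrow> (\<lambda>_. 0)" "\<And>k. rho_name \<nu> (X k) (of_rat c / 2 ^ k)"
proof
  \<comment> \<open>Up to position \<open>k\<close> the index \<open>0\<close> of the rational zero
    is precise enough, because \<open>c / 2^k \<le> 1 / 2^i\<close> for \<open>i \<le> k\<close>;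
    from then on the exact index of \<open>c / 2^k\<close> is used.\<close>
  define X where "X k i = (if i \<le> k then 0 else inv_into UNIV \<nu> (c / 2 ^ k))" for k i :: nat
  show "X \<longlonglongrightarrow> (\<lambda>_. 0)"
    unfolding baire_tendsto_iff
  proof
    fix i
    show "\<forall>\<^sub>F k in sequentially. X k i = 0"
      using eventually_ge_at_top[of i] by eventually_elim (simp add: X_def)
  qed
  fix k
  have "of_rat c / 2 ^ k \<le> (1 / 2 ^ i :: real)" if "i \<le> k" for i
    using assms(3,4) that by (intro frac_le) (auto simp: power_increasing)
  then show "rho_name \<nu> (X k) (of_rat c / 2 ^ k)"
    using assms by (auto simp: rho_name_def X_def surj_f_inv_f bij_is_surj of_rat_divide of_rat_power)
qed

theorem theorem13:
  fixes \<nu> :: "nat \<Rightarrow> rat"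
  assumes "rat_numbering \<nu>"
  shows "\<not> rDiv \<nu> \<le>\<^sub>2 Pure \<nu>"
proof
  assume "rDiv \<nu> \<le>\<^sub>2 Pure \<nu>"
  define D where "D = {(u, v). \<exists>x y. rho_name \<nu> u x \<and> rho_name \<nu> v y \<and> 0 \<le> x \<and> x \<le> y}"
  define R where "R = (\<lambda>(u, v). {d. (\<exists>z. rho_name \<nu> d z) \<and>
     (\<forall>x y. rho_name \<nu> u x \<and> rho_name \<nu> v y \<and> y > 0 \<longrightarrow> rho_name \<nu> d (x / y))})"
  have bij: "bij \<nu>" and zero: "\<nu> 0 = 0"
    using assms by (auto simp: rat_numbering_def)
  obtain F G where cont: "continuous_partial F" "continuous_partial G"
    and red: "\<And>w. w \<in> D \<Longrightarrow> \<exists>v\<in>{v. \<exists>\<G>. game_name \<nu> v \<G> \<and> pure_equilibria \<G> \<noteq> {}}.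
      G w = Some v \<and> (\<forall>e\<in>{e. \<exists>\<G>. game_name \<nu> v \<G> \<and> e \<in> pure_equilibria \<G>}.
        \<exists>d\<in>R w. F (w, e) = Some d)"
    using \<open>rDiv \<nu> \<le>\<^sub>2 Pure \<nu>\<close> unfolding rDiv_def Pure_def D_def R_def
    by (rule reducible2_choice_functionsE) auto
  have red': "\<exists>v \<G>. G w = Some v \<and> game_name \<nu> v \<G> \<and> pure_equilibria \<G> \<noteq> {} \<and>
      (\<forall>e\<in>pure_equilibria \<G>. \<exists>d\<in>R w. F (w, e) = Some d)" if "w \<in> D" for w
    using red[OF that] by blast
  \<comment> \<open>At the pair of zero names the denominator is \<open>0\<close>, so the output of
    the division may name any real.\<close>
  define p where "p = ((\<lambda>_. 0, \<lambda>_. 0) :: baire \<times> baire)"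
  have "rho_name \<nu> (\<lambda>_. 0) 0" by (simp add: rho_name_def zero)
  then have "p \<in> D" by (auto simp: D_def p_def)
  then obtain v0 \<H> where v0: "G p = Some v0" "game_name \<nu> v0 \<H>"
    and F0: "\<And>e. e \<in> pure_equilibria \<H> \<Longrightarrow> \<exists>d\<in>R p. F (p, e) = Some d"
    using red' by blast
  have "\<exists>z. \<exists>d. F (p, e) = Some d \<and> rho_name \<nu> d z" if "e \<in> pure_equilibria \<H>" for e
    using F0[OF that] by (auto simp: R_def p_def)
  \<comment> \<open>\<open>z e\<close> is the real that the reduction returns at \<open>p\<close>
    when given the equilibrium \<open>e\<close>; finiteness of the set of equilibria leaves finitely
    many such reals.\<close>
  then obtain z where z: "\<And>e. e \<in> pure_equilibria \<H> \<Longrightarrow> \<exists>d. F (p, e) = Some d \<and> rho_name \<nu> d (z e)"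
    by metis
  \<comment> \<open>Only rational ratios are treated, since then \<open>c / 2^k\<close> has an exact
    index under \<open>\<nu>\<close>.\<close>
  have "of_rat c \<in> z ` pure_equilibria \<H>" if c: "c \<in> {0..1}" for c
  proof -
    obtain U where U: "U \<longlonglongrightarrow> (\<lambda>_. 0)" "\<And>k. rho_name \<nu> (U k) (of_rat c / 2 ^ k)"
      using rho_name_null_sequence[OF bij zero] c by (metis atLeastAtMost_iff)
    obtain V where V: "V \<longlonglongrightarrow> (\<lambda>_. 0)" "\<And>k. rho_name \<nu> (V k) (1 / 2 ^ k)"
      using rho_name_null_sequence[OF bij zero, of 1] by auto
    define S where "S k = (U k, V k)" for k
    have S: "S \<longlonglongrightarrow> p"
      unfolding S_def p_def by (intro tendsto_Pair U(1) V(1))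
    have "0 \<le> (of_rat c / 2 ^ k :: real)" "of_rat c / 2 ^ k \<le> (1 / 2 ^ k :: real)" for k
      using c by (auto intro: divide_right_mono)
    then have SD: "S k \<in> D" for k
      unfolding D_def S_def using U(2) V(2) by blast
    have ratio: "rho_name \<nu> d (of_rat c)" if "d \<in> R (S k)" for d k
    proof -
      have "rho_name \<nu> d ((of_rat c / 2 ^ k) / (1 / 2 ^ k))"
        using that U(2)[of k] V(2)[of k] unfolding R_def S_def by fastforce
      then show ?thesis by simp
    qed
    \<comment> \<open>For every \<open>k\<close>, some equilibrium of the game assigned to
      \<open>S k\<close> is turned by \<open>F\<close> into a name of the quotient
      \<open>c\<close>.\<close>
    have "\<exists>v \<G> e d. G (S k) = Some v \<and> game_name \<nu> v \<G> \<and> e \<in> pure_equilibria \<G> \<and>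
        F (S k, e) = Some d \<and> rho_name \<nu> d (of_rat c)" for k
      using red'[OF SD[of k]] ratio by blast
    then obtain W \<G> e d where W: "\<And>k. G (S k) = Some (W k)" "\<And>k. game_name \<nu> (W k) (\<G> k)"
      and e: "\<And>k. e k \<in> pure_equilibria (\<G> k)"
      and d: "\<And>k. F (S k, e k) = Some (d k)" "\<And>k. rho_name \<nu> (d k) (of_rat c)"
      by metis
    have Wlim: "W \<longlonglongrightarrow> v0"
      using continuous_partial_tendsto[OF cont(2) S W(1) v0(1)] .
    define n m where "n = v0 0" and "m = v0 1"
    have "\<forall>\<^sub>F k in sequentially. W k 0 = n \<and> W k 1 = m"
      using Wlim by (simp add: baire_tendsto_iff n_def m_def eventually_conj_iff)
    then obtain N where N: "\<And>k. k \<ge> N \<Longrightarrow> W k 0 = n \<and> W k 1 = m"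
      by (auto simp: eventually_sequentially)
    \<comment> \<open>The size is eventually that of \<open>\<H>\<close>, so from \<open>N\<close>
      on the chosen equilibria range over a finite grid and one of them recurs infinitely
      often.\<close>
    have "e k \<in> {..<n} \<times> {..<m}" if "k \<ge> N" for k
      using e[of k] W(2)[of k] N[OF that]
      by (auto simp: pure_equilibria_def game_name_def bimatrix_game_def split: prod.splits)
    then have "e ` {N..} \<subseteq> {..<n} \<times> {..<m}"
      by (intro image_subsetI) (simp only: atLeast_iff)
    then have "finite (e ` {N..})"
      by (rule finite_subset) simp
    then obtain k0 where "infinite {k \<in> {N..}. e k = e k0}"
      using pigeonhole_infinite[of "{N..}" e] infinite_Ici by blast
    then obtain r :: "nat \<Rightarrow> nat" where r: "strict_mono r" "\<And>k. e (r k) = e k0"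
      using infinite_enumerate by blast
    \<comment> \<open>Along the subsequence \<open>r\<close> the equilibrium is constantly
      \<open>e k0\<close>, so it passes to the limit game.\<close>
    have e0: "e k0 \<in> pure_equilibria \<H>"
    proof (rule pure_equilibrium_limit[OF LIMSEQ_subseq_LIMSEQ[OF Wlim r(1)] _ v0(2)])
      fix k
      show "game_name \<nu> ((W \<circ> r) k) ((\<G> \<circ> r) k)"
        by (simp add: W(2))
      show "e k0 \<in> pure_equilibria ((\<G> \<circ> r) k)"
        using e[of "r k"] by (simp only: r(2) comp_apply)
    qed
    obtain d0 where d0: "F (p, e k0) = Some d0" "rho_name \<nu> d0 (z (e k0))"
      using z[OF e0] by blast
    \<comment> \<open>With the second argument fixed, continuity of \<open>F\<close> at
      \<open>(p, e k0)\<close> makes the names \<open>d (r k)\<close> of \<open>c\<close> converge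
      to the name \<open>d0\<close> of \<open>z (e k0)\<close>, which forces the two reals to be
      equal.\<close>
    have "(\<lambda>k. ((S \<circ> r) k, e k0)) \<longlonglongrightarrow> (p, e k0)"
      by (intro tendsto_Pair LIMSEQ_subseq_LIMSEQ[OF S r(1)] tendsto_const)
    then have "(\<lambda>k. d (r k)) \<longlonglongrightarrow> d0"
    proof (rule continuous_partial_tendsto[OF cont(1) _ _ d0(1)])
      show "F ((S \<circ> r) k, e k0) = Some (d (r k))" for k
        using d(1)[of "r k"] by (simp only: r(2) comp_apply)
    qed
    then have "(\<lambda>k. of_rat c) \<longlonglongrightarrow> z (e k0)"
      by (rule rho_name_tendsto[OF _ d(2) d0(2)])
    then have "of_rat c = z (e k0)"
      by (simp add: LIMSEQ_const_iff)
    then show ?thesis using e0 by blast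
  qed
  then have "of_rat ` {0..1 :: rat} \<subseteq> z ` pure_equilibria \<H>" by blast
  then have "finite (of_rat ` {0..1 :: rat} :: real set)"
    using finite_pure_equilibria finite_subset by blast
  \<comment> \<open>\<open>of_rat\<close> is injective, so finiteness is inherited by the rational
    unit interval, which is infinite.\<close>
  then have "finite {0..1 :: rat}"
    by (rule finite_imageD) (auto simp: inj_on_def)
  then show False
    using infinite_Icc[of "0 :: rat" 1] by simp
qed

end
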